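(* Let $A$ and $B$ be Hermitian $2\times 2$ matrices (with complex entries). Then the function $f_{A,B}:\mathbb{R}\to\mathbb{R}$, $f_{A,B}(t)=\operatorname{trace}\, e^{tA+B}$, is exponentially convex.
   Context: A function $f:\mathbb{R}\to[0,\infty)$ is called exponentially convex if (1) for every nonnegative integer $N$, all real numbers $t_1,\dots,t_N$ and all complex numbers $\xi_1,\dots,\xi_N$ one has $\sum_{r,s=1}^{N} f(t_r+t_s)\,\xi_r\overline{\xi_s}\ge 0$; and (2) $f$ is continuous on $\mathbb{R}$. Here $e^{X}$ denotes the matrix exponential. *)

theory Defs
  imports "HOL-Analysis.Analysis"
begin

text \<open>Exponential convexity. Membership in the set of nonnegative reals expresses that the (a priori
  complex) quadratic form is real and nonnegative.\<close>

definition exponentially_convex :: "(real \<Rightarrow> real) \<Rightarrow> bool" where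
  "exponentially_convex f \<longleftrightarrow>
     (\<forall>t. 0 \<le> f t) \<and>
     (\<forall>(N::nat) (t :: nat \<Rightarrow> real) (\<xi> :: nat \<Rightarrow> complex).
        (\<Sum>r=1..N. \<Sum>s=1..N. complex_of_real (f (t r + t s)) * \<xi> r * cnj (\<xi> s)) \<in> \<real>\<^sub>\<ge>\<^sub>0) \<and>
     continuous_on UNIV f"

definition hermitian :: "complex^'n^'n \<Rightarrow> bool" where
  "hermitian A \<longleftrightarrow> (\<chi> i j. cnj (A $ j $ i)) = A"

text \<open>The library makes vectors a ring with componentwise multiplication, so neither \<open>X ^ n\<close> nor
  \<open>exp X\<close> denotes the matrix operation; both are set up here from the matrix product.\<close>

primrec matrix_power :: "complex^'n^'n \<Rightarrow> nat \<Rightarrow> complex^'n^'n" where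
  "matrix_power X 0 = mat 1"
| "matrix_power X (Suc n) = X ** matrix_power X n"

definition matrix_exp :: "complex^'n^'n \<Rightarrow> complex^'n^'n" where
  "matrix_exp X = (\<Sum>n. (1 / fact n) *\<^sub>R matrix_power X n)"

lemma norm_matrix_power_entry_le:
  fixes X :: "complex^'n^'n"
  shows "norm (matrix_power X n $ i $ j) \<le> (real CARD('n) * norm X) ^ n"
proof (induction n arbitrary: i j)
  case 0
  then show ?case by (simp add: mat_def)
next
  case (Suc n)
  have entry: "norm (X $ i $ k) \<le> norm X" for k
    by (meson Finite_Cartesian_Product.norm_nth_le order_trans)
  have "norm (matrix_power X (Suc n) $ i $ j) \<le> (\<Sum>k\<in>UNIV. norm (X $ i $ k * matrix_power X n $ k $ j))"
    by (simp add: matrix_matrix_mult_def norm_sum)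
  also have "\<dots> \<le> (\<Sum>k\<in>(UNIV::'n set). norm X * (real CARD('n) * norm X) ^ n)"
    unfolding norm_mult by (intro sum_mono mult_mono entry Suc.IH) auto
  also have "\<dots> = (real CARD('n) * norm X) ^ Suc n"
    by simp
  finally show ?case .
qed

lemma summable_matrix_exp:
  fixes X :: "complex^'n^'n"
  shows "summable (\<lambda>n. (1 / fact n) *\<^sub>R matrix_power X n)"
proof (rule summable_comparison_test)
  let ?c = "real CARD('n) * norm X"
  have bound: "norm (matrix_power X n) \<le> (\<Sum>i\<in>(UNIV::'n set). \<Sum>j\<in>(UNIV::'n set). ?c ^ n)" for n
  proof -
    have "norm (matrix_power X n) \<le> (\<Sum>i\<in>UNIV. norm (matrix_power X n $ i))"
      unfolding norm_vec_def[of "matrix_power X n"] by (rule L2_set_le_sum) simp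
    also have "\<dots> \<le> (\<Sum>i\<in>UNIV. \<Sum>j\<in>UNIV. norm (matrix_power X n $ i $ j))"
    proof (rule sum_mono)
      fix i
      show "norm (matrix_power X n $ i) \<le> (\<Sum>j\<in>UNIV. norm (matrix_power X n $ i $ j))"
        unfolding norm_vec_def[of "matrix_power X n $ i"] by (rule L2_set_le_sum) simp
    qed
    also have "\<dots> \<le> (\<Sum>i\<in>(UNIV::'n set). \<Sum>j\<in>(UNIV::'n set). ?c ^ n)"
      by (intro sum_mono norm_matrix_power_entry_le)
    finally show ?thesis .
  qed
  have "norm ((1 / fact n) *\<^sub>R matrix_power X n) \<le> (real CARD('n))\<^sup>2 * (inverse (fact n) * ?c ^ n)" for n
    using mult_left_mono[OF bound[of n], of "inverse (fact n)"]
    by (simp add: power2_eq_square field_simps)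
  then show "\<exists>N. \<forall>n\<ge>N. norm ((1 / fact n) *\<^sub>R matrix_power X n)
      \<le> (real CARD('n))\<^sup>2 * (inverse (fact n) * ?c ^ n)"
    by blast
  show "summable (\<lambda>n. (real CARD('n))\<^sup>2 * (inverse (fact n) * ?c ^ n))"
    by (intro summable_mult summable_exp)
qed

end

theory Submission
  imports Defs "HOL-Real_Asymp.Real_Asymp"
begin

text \<open>The trace of the exponential of a Hermitian 2 by 2 matrix is twice the exponential of the mean of
  its eigenvalues times the hyperbolic cosine of half their difference. For \<open>t A + B\<close> the mean is affine
  in \<open>t\<close> and the square of the half-difference is a nonnegative quadratic polynomial, so after an affine
  substitution the claim is that \<open>cosh (sqrt (t\<^sup>2 + d\<^sup>2))\<close> is exponentially convex for \<open>d \<ge> 0\<close>. This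
  function is half the trace of \<open>exp (t \<sigma> + d \<tau>)\<close> with \<open>\<sigma> = diag (1, -1)\<close> and \<open>\<tau> = antidiag (1, 1)\<close>.
  By the Trotter formula it is the limit of half the trace of \<open>(exp (t \<sigma> / n) exp (d \<tau> / n))\<^sup>n\<close>, and
  since \<open>exp (d \<tau> / n)\<close> has nonnegative entries, these traces are combinations of exponentials in \<open>t\<close>
  with nonnegative coefficients. The approximants have the closed form \<open>cosh (n \<theta>)\<close> with
  \<open>cosh \<theta> = cosh (t / n) cosh (d / n)\<close>, which makes the limit elementary.\<close>

section \<open>Closure properties of the positivity condition\<close>

text \<open>Only the positivity clause of \<open>exponentially_convex\<close> is isolated: it passes
  to pointwise limits, which continuity does not.\<close>

definition posdef :: "(real \<Rightarrow> real) \<Rightarrow> bool" where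
  "posdef f \<longleftrightarrow> (\<forall>(N::nat) (t :: nat \<Rightarrow> real) (\<xi> :: nat \<Rightarrow> complex).
     (\<Sum>r=1..N. \<Sum>s=1..N. complex_of_real (f (t r + t s)) * \<xi> r * cnj (\<xi> s)) \<in> \<real>\<^sub>\<ge>\<^sub>0)"

lemma posdef_const:
  assumes "c \<ge> 0"
  shows "posdef (\<lambda>_. c)"
  unfolding posdef_def
proof (intro allI)
  fix N :: nat and t :: "nat \<Rightarrow> real" and \<xi> :: "nat \<Rightarrow> complex"
  have "(\<Sum>r=1..N. \<Sum>s=1..N. complex_of_real c * \<xi> r * cnj (\<xi> s)) =
      complex_of_real c * ((\<Sum>r=1..N. \<xi> r) * cnj (\<Sum>r=1..N. \<xi> r))"
    by (simp add: sum_distrib_left sum_distrib_right mult_ac)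
      (rule sum.swap)
  also have "\<dots> = complex_of_real (c * (cmod (\<Sum>r=1..N. \<xi> r))\<^sup>2)"
    by (simp only: complex_norm_square[symmetric] of_real_mult)
  also have "\<dots> \<in> \<real>\<^sub>\<ge>\<^sub>0"
    using assms by (simp only: nonneg_Reals_of_real_iff) simp
  finally show "(\<Sum>r=1..N. \<Sum>s=1..N. complex_of_real c * \<xi> r * cnj (\<xi> s)) \<in> \<real>\<^sub>\<ge>\<^sub>0" .
qed

lemma posdef_add:
  assumes "posdef f" and "posdef g"
  shows "posdef (\<lambda>t. f t + g t)"
  using assms unfolding posdef_def
  by (simp add: distrib_right sum.distrib nonneg_Reals_add_I)

lemma posdef_cmult:
  assumes "posdef f" and "c \<ge> 0"
  shows "posdef (\<lambda>t. c * f t)"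
  unfolding posdef_def
proof (intro allI)
  fix N :: nat and t :: "nat \<Rightarrow> real" and \<xi> :: "nat \<Rightarrow> complex"
  have "complex_of_real c *
      (\<Sum>r=1..N. \<Sum>s=1..N. complex_of_real (f (t r + t s)) * \<xi> r * cnj (\<xi> s)) \<in> \<real>\<^sub>\<ge>\<^sub>0"
    using assms unfolding posdef_def by (intro nonneg_Reals_mult_I) auto
  then show "(\<Sum>r=1..N. \<Sum>s=1..N. complex_of_real (c * f (t r + t s)) * \<xi> r * cnj (\<xi> s)) \<in> \<real>\<^sub>\<ge>\<^sub>0"
    by (simp add: sum_distrib_left mult.assoc)
qed

text \<open>As \<open>exp (a * (x + y)) = exp (a * x) * exp (a * y)\<close>, the real factor is
  absorbed into the coefficients \<open>\<xi>\<close>.\<close>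

lemma posdef_mult_exp:
  assumes "posdef f"
  shows "posdef (\<lambda>t. exp (a * t) * f t)"
  unfolding posdef_def
proof (intro allI)
  fix N :: nat and t :: "nat \<Rightarrow> real" and \<xi> :: "nat \<Rightarrow> complex"
  let ?\<eta> = "\<lambda>r. complex_of_real (exp (a * t r)) * \<xi> r"
  have "(\<Sum>r=1..N. \<Sum>s=1..N. complex_of_real (f (t r + t s)) * ?\<eta> r * cnj (?\<eta> s)) \<in> \<real>\<^sub>\<ge>\<^sub>0"
    by (rule assms[unfolded posdef_def, rule_format])
  then show "(\<Sum>r=1..N. \<Sum>s=1..N. complex_of_real (exp (a * (t r + t s)) * f (t r + t s)) *
      \<xi> r * cnj (\<xi> s)) \<in> \<real>\<^sub>\<ge>\<^sub>0"
    by (simp add: distrib_left exp_add mult_ac del: of_real_exp)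
qed

text \<open>Giving half of the shift \<open>q\<close> to each node turns the form into that of
  \<open>f\<close> at the nodes \<open>p * t r + q / 2\<close>.\<close>

lemma posdef_affine:
  assumes "posdef f"
  shows "posdef (\<lambda>t. f (p * t + q))"
  unfolding posdef_def
proof (intro allI)
  fix N :: nat and t :: "nat \<Rightarrow> real" and \<xi> :: "nat \<Rightarrow> complex"
  have eq: "p * (x + y) + q = (p * x + q / 2) + (p * y + q / 2)" for x y
    by (simp add: field_simps)
  show "(\<Sum>r=1..N. \<Sum>s=1..N. complex_of_real (f (p * (t r + t s) + q)) *
      \<xi> r * cnj (\<xi> s)) \<in> \<real>\<^sub>\<ge>\<^sub>0"
    unfolding eq by (rule assms[unfolded posdef_def, rule_format])
qed

lemma posdef_LIMSEQ:
  assumes "\<And>n. posdef (f n)" and "\<And>t. (\<lambda>n. f n t) \<longlonglongrightarrow> g t"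
  shows "posdef g"
  unfolding posdef_def
proof (intro allI)
  fix N :: nat and t :: "nat \<Rightarrow> real" and \<xi> :: "nat \<Rightarrow> complex"
  let ?S = "\<lambda>f. \<Sum>r=1..N. \<Sum>s=1..N. complex_of_real (f (t r + t s)) * \<xi> r * cnj (\<xi> s)"
  have "(\<lambda>n. ?S (f n)) \<longlonglongrightarrow> ?S g"
    by (intro tendsto_sum tendsto_mult tendsto_of_real tendsto_const assms(2))
  moreover have "?S (f n) \<in> \<real>\<^sub>\<ge>\<^sub>0" for n
    using assms(1) unfolding posdef_def by blast
  ultimately show "?S g \<in> \<real>\<^sub>\<ge>\<^sub>0"
    using closed_sequentially[OF closed_nonneg_Reals_complex, of "\<lambda>n. ?S (f n)"] by blast
qed

section \<open>Trotter products and their traces\<close>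

text \<open>The vectors \<open>(exp (u \<sigma>) exp (s \<tau>))\<^sup>k v\<close>.\<close>

primrec trotter_orbit :: "real \<Rightarrow> real \<Rightarrow> real \<times> real \<Rightarrow> nat \<Rightarrow> real \<times> real" where
  "trotter_orbit s u v 0 = v"
| "trotter_orbit s u v (Suc k) =
    (exp u * (cosh s * fst (trotter_orbit s u v k) + sinh s * snd (trotter_orbit s u v k)),
     exp (- u) * (sinh s * fst (trotter_orbit s u v k) + cosh s * snd (trotter_orbit s u v k)))"

text \<open>The condition \<open>s \<ge> 0\<close> makes \<open>sinh s\<close> nonnegative, so each
  step of the orbit uses only the closure properties above.\<close>

lemma posdef_trotter_orbit:
  assumes "s \<ge> 0" and "fst v \<ge> 0" and "snd v \<ge> 0"
  shows "posdef (\<lambda>u. fst (trotter_orbit s u v k)) \<and> posdef (\<lambda>u. snd (trotter_orbit s u v k))"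
proof (induction k)
  case 0
  then show ?case using assms by (simp add: posdef_const)
next
  case (Suc k)
  let ?x = "\<lambda>u. fst (trotter_orbit s u v k)" and ?y = "\<lambda>u. snd (trotter_orbit s u v k)"
  have "posdef (\<lambda>u. exp (1 * u) * (cosh s * ?x u + sinh s * ?y u))"
       "posdef (\<lambda>u. exp (-1 * u) * (sinh s * ?x u + cosh s * ?y u))"
    using Suc assms(1) by (intro posdef_mult_exp posdef_add posdef_cmult; simp)+
  then show ?case by simp
qed

text \<open>Cayley-Hamilton for one Trotter step, a matrix of determinant 1 and trace
  \<open>2 * cosh u * cosh s\<close>.\<close>

lemma trotter_orbit_recurrence:
  fixes s u :: real and v :: "real \<times> real"
  defines "w \<equiv> trotter_orbit s u v"
  shows "fst (w (Suc (Suc k))) = 2 * (cosh u * cosh s) * fst (w (Suc k)) - fst (w k)"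
    and "snd (w (Suc (Suc k))) = 2 * (cosh u * cosh s) * snd (w (Suc k)) - snd (w k)"
proof -
  have "P * (C * (P * (C * x + S * y)) + S * (Q * (S * x + C * y))) =
        2 * (K * C) * (P * (C * x + S * y)) - x"
      "Q * (S * (P * (C * x + S * y)) + C * (Q * (S * x + C * y))) =
        2 * (K * C) * (Q * (S * x + C * y)) - y"
    if "P * Q = 1" "2 * K = P + Q" "C\<^sup>2 - S\<^sup>2 = 1" for P Q C S K x y :: real
    using that by algebra+
  note ident = this[of "exp u" "exp (- u)" "cosh u" "cosh s" "sinh s" "fst (w k)" "snd (w k)"]
  have "exp u * exp (- u) = 1" "2 * cosh u = exp u + exp (- u)" "(cosh s)\<^sup>2 - (sinh s)\<^sup>2 = 1"
    by (simp add: exp_minus, simp add: cosh_field_def, simp add: cosh_square_eq)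
  note ident = ident[OF this]
  show "fst (w (Suc (Suc k))) = 2 * (cosh u * cosh s) * fst (w (Suc k)) - fst (w k)"
    using ident(1) by (simp add: w_def)
  show "snd (w (Suc (Suc k))) = 2 * (cosh u * cosh s) * snd (w (Suc k)) - snd (w k)"
    using ident(2) by (simp add: w_def)
qed

lemma cosh_recurrence:
  fixes \<theta> :: real
  shows "cosh (real (Suc (Suc k)) * \<theta>) = 2 * cosh \<theta> * cosh (real (Suc k) * \<theta>) - cosh (real k * \<theta>)"
proof -
  have "cosh (real (Suc k) * \<theta> + \<theta>) + cosh (real (Suc k) * \<theta> - \<theta>) = 2 * cosh \<theta> * cosh (real (Suc k) * \<theta>)"
    by (simp add: cosh_add cosh_diff)
  moreover have "real (Suc k) * \<theta> + \<theta> = real (Suc (Suc k)) * \<theta>" "real (Suc k) * \<theta> - \<theta> = real k * \<theta>"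
    by (simp_all add: algebra_simps)
  ultimately show ?thesis by simp
qed

text \<open>The left side is the trace of the \<open>k\<close>-th power of the step matrix; both
  sides obey the same two-term recurrence and agree at 0 and 1.\<close>

lemma trotter_trace:
  assumes "cosh \<theta> = cosh u * cosh s"
  shows "fst (trotter_orbit s u (1, 0) k) + snd (trotter_orbit s u (0, 1) k) = 2 * cosh (real k * \<theta>)"
proof (induction k rule: induct_nat_012)
  case 0
  then show ?case by simp
next
  case 1
  then show ?case using assms by (simp add: cosh_field_def field_simps)
next
  case (ge2 k)
  show ?case
    unfolding trotter_orbit_recurrence cosh_recurrence using ge2 assms by algebra
qed

text \<open>This is the arcosh of \<open>cosh u * cosh s\<close>, written with \<open>arsinh\<close>
  because \<open>arsinh x / x\<close> tends to 1 at 0, which yields the limit below.\<close>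

definition trotter_angle :: "real \<Rightarrow> real \<Rightarrow> real" where
  "trotter_angle u s = arsinh (sqrt ((cosh u * cosh s)\<^sup>2 - 1))"

lemma cosh_trotter_angle: "cosh (trotter_angle u s) = cosh u * cosh s"
proof -
  have "1 \<le> cosh u * cosh s"
    using mult_mono[of 1 "cosh u" 1 "cosh s"] by (simp add: cosh_real_ge_1)
  then show ?thesis
    by (simp add: trotter_angle_def cosh_arsinh_real)
qed

lemma trotter_angle_limit:
  assumes "d > 0"
  shows "(\<lambda>n. real n * trotter_angle (t / real n) (d / real n)) \<longlonglongrightarrow> sqrt (t\<^sup>2 + d\<^sup>2)"
proof -
  define y where "y = (\<lambda>n. sqrt ((cosh (t / real n) * cosh (d / real n))\<^sup>2 - 1))"
  \<comment> \<open>Writing the radicand as a sum of squares lets the factor \<open>n\<close> enter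
    each \<open>sinh\<close> term; the scaled terms tend to \<open>t\<close> and
    \<open>d\<close>.\<close>
  have factor: "(cosh u * cosh s)\<^sup>2 - 1 = (sinh u * cosh s)\<^sup>2 + (sinh s)\<^sup>2" for u s :: real
    unfolding power_mult_distrib cosh_square_eq by algebra
  have scaled: "real n * y n = sqrt ((real n * sinh (t / real n) * cosh (d / real n))\<^sup>2 +
      (real n * sinh (d / real n))\<^sup>2)" for n
  proof -
    have "real n * y n = sqrt ((real n)\<^sup>2 * ((sinh (t / real n) * cosh (d / real n))\<^sup>2 + (sinh (d / real n))\<^sup>2))"
      by (simp add: y_def factor real_sqrt_mult)
    then show ?thesis
      by (simp add: distrib_left power_mult_distrib)
  qed
  have sinh_limit: "(\<lambda>n. real n * sinh (c / real n)) \<longlonglongrightarrow> c" for c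
    by (cases c "0::real" rule: linorder_cases) (real_asymp | simp)+
  have null: "(\<lambda>n. c / real n) \<longlonglongrightarrow> 0" for c
    by (rule lim_const_over_n)
  have cosh_limit: "(\<lambda>n. cosh (c / real n)) \<longlonglongrightarrow> 1" for c :: real
    using tendsto_cosh[OF null[of c]] by simp
  have "(\<lambda>n. real n * y n) \<longlonglongrightarrow> sqrt ((t * 1)\<^sup>2 + d\<^sup>2)"
    unfolding scaled by (intro tendsto_intros sinh_limit cosh_limit)
  moreover have "(\<lambda>n. arsinh (y n) / y n) \<longlonglongrightarrow> 1"
  proof (rule filterlim_compose[of "\<lambda>x. arsinh x / x" _ "at 0"])
    show "((\<lambda>x::real. arsinh x / x) \<longlongrightarrow> 1) (at 0)"
      by real_asymp
    have "y \<longlonglongrightarrow> sqrt ((1 * 1)\<^sup>2 - 1)"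
      unfolding y_def by (intro tendsto_intros cosh_limit)
    \<comment> \<open>At \<open>n = 0\<close> division by zero gives \<open>y 0 = 0\<close>; for
      \<open>n > 0\<close> the assumption \<open>d > 0\<close> makes
      \<open>sinh (d / real n)\<close> nonzero.\<close>
    moreover have "\<forall>\<^sub>F n in sequentially. y n \<noteq> 0"
      using eventually_gt_at_top[of 0]
    proof eventually_elim
      case (elim n)
      then show ?case using assms unfolding y_def factor by (simp add: add_nonneg_eq_0_iff)
    qed
    ultimately show "filterlim y (at 0) sequentially"
      by (simp add: filterlim_at)
  qed
  ultimately have "(\<lambda>n. real n * y n * (arsinh (y n) / y n)) \<longlonglongrightarrow> sqrt ((t * 1)\<^sup>2 + d\<^sup>2) * 1"
    by (rule tendsto_mult)
  moreover have "trotter_angle (t / real n) (d / real n) = arsinh (y n)" for n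
    by (simp add: trotter_angle_def y_def)
  \<comment> \<open>If \<open>y n = 0\<close>, both sides vanish, since
    \<open>arsinh 0 = 0\<close>.\<close>
  then have "real n * y n * (arsinh (y n) / y n) = real n * trotter_angle (t / real n) (d / real n)" for n
    by simp
  ultimately show ?thesis
    by simp
qed

lemma posdef_cosh_sqrt_sum_squares:
  assumes "d > 0"
  shows "posdef (\<lambda>t. cosh (sqrt (t\<^sup>2 + d\<^sup>2)))"
proof (rule posdef_LIMSEQ)
  fix n :: nat
  let ?s = "d / real n"
  let ?f = "\<lambda>u. (1/2) * (fst (trotter_orbit ?s u (1, 0) n) + snd (trotter_orbit ?s u (0, 1) n))"
  have "posdef ?f"
    using assms by (intro posdef_cmult posdef_add) (simp_all add: posdef_trotter_orbit)
  then have "posdef (\<lambda>t. ?f ((1 / real n) * t + 0))"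
    by (rule posdef_affine)
  then show "posdef (\<lambda>t. cosh (real n * trotter_angle (t / real n) ?s))"
    by (simp add: trotter_trace[OF cosh_trotter_angle])
next
  fix t
  show "(\<lambda>n. cosh (real n * trotter_angle (t / real n) (d / real n))) \<longlonglongrightarrow> cosh (sqrt (t\<^sup>2 + d\<^sup>2))"
    by (intro tendsto_cosh trotter_angle_limit assms)
qed

section \<open>Square roots of nonnegative quadratics\<close>

lemma posdef_cosh: "posdef cosh"
proof -
  have "posdef (\<lambda>t. (1/2) * (exp (1 * t) * 1 + exp (-1 * t) * 1))"
    by (intro posdef_cmult posdef_add posdef_mult_exp posdef_const) auto
  then show ?thesis
    by (simp add: cosh_field_def[abs_def])
qed

text \<open>Completing the square reduces the quadratic to \<open>t\<^sup>2 + d\<^sup>2\<close>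
  after an affine substitution.\<close>

lemma posdef_cosh_sqrt_quadratic:
  assumes nonneg: "\<And>t. a * t\<^sup>2 + 2 * b * t + c \<ge> 0"
  shows "posdef (\<lambda>t. cosh (sqrt (a * t\<^sup>2 + 2 * b * t + c)))"
proof -
  have c: "c \<ge> 0"
    using nonneg[of 0] by simp
  have a: "a \<ge> 0"
  proof (rule ccontr)
    assume "\<not> a \<ge> 0"
    then have "\<exists>t. a * t\<^sup>2 + 2 * b * t + c < 0"
      by (intro eventually_happens'[of at_top]) (simp, real_asymp)
    then show False using nonneg by (meson not_le)
  qed
  \<comment> \<open>For \<open>a = 0\<close> division by zero makes \<open>q = 0\<close>, leaving
    the constant \<open>c\<close>; otherwise \<open>e\<close> is the minimum of the
    quadratic.\<close>
  define p q e where "p = sqrt a" and "q = b / sqrt a" and "e = (if a = 0 then c else c - b\<^sup>2 / a)"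
  have e: "e \<ge> 0"
  proof (cases "a = 0")
    case False
    have "a * (- b / a)\<^sup>2 + 2 * b * (- b / a) + c = c - b\<^sup>2 / a"
      using False by (simp add: power2_eq_square field_simps)
    then show ?thesis using nonneg[of "- b / a"] False by (simp add: e_def)
  qed (use c in \<open>simp add: e_def\<close>)
  have b: "b = 0" if "a = 0"
  proof (rule ccontr)
    assume "b \<noteq> 0"
    \<comment> \<open>At this point the linear function \<open>2 * b * t + c\<close> takes the value
      -1.\<close>
    then have "2 * b * (- (c + 1) / (2 * b)) = - (c + 1)" by (simp add: field_simps)
    then show False using nonneg[of "- (c + 1) / (2 * b)"] that by simp
  qed
  have square: "a * t\<^sup>2 + 2 * b * t + c = (p * t + q)\<^sup>2 + (sqrt e)\<^sup>2" for t
  proof (cases "a = 0")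
    case True
    then show ?thesis using b c by (simp add: p_def q_def e_def)
  next
    case False
    have "(p * t + q)\<^sup>2 = (sqrt a)\<^sup>2 * t\<^sup>2 + 2 * (sqrt a * q) * t + q\<^sup>2"
      by (simp add: p_def power2_eq_square algebra_simps)
    moreover have "sqrt a * q = b" "q\<^sup>2 = b\<^sup>2 / a"
      using a False by (simp_all add: q_def power_divide)
    ultimately show ?thesis using a e False by (simp add: e_def)
  qed
  have "posdef (\<lambda>t. cosh (sqrt (t\<^sup>2 + (sqrt e)\<^sup>2)))"
  \<comment> \<open>The Trotter limit was taken for \<open>d > 0\<close>; for \<open>e = 0\<close>
    the function is \<open>cosh\<close> of an absolute value.\<close>
  proof (cases "e = 0")
    case True
    then show ?thesis using posdef_cosh by (simp add: cosh_real_abs)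
  next
    case False
    then show ?thesis using e by (intro posdef_cosh_sqrt_sum_squares) simp
  qed
  from posdef_affine[OF this, of p q] show ?thesis
    unfolding square .
qed

section \<open>Traces of exponentials of 2 by 2 matrices\<close>

lemma trace_2: "trace X = X $ 1 $ 1 + X $ 2 $ 2" for X :: "'a::comm_ring_1^2^2"
  by (simp add: trace_def sum_2)

text \<open>The Cayley--Hamilton theorem gives the power sums of the eigenvalues a two-term recurrence.\<close>

lemma trace_matrix_power_2:
  fixes X :: "complex^2^2"
  assumes tr: "trace X = \<nu> + \<mu>" and det: "det X = \<nu> * \<mu>"
  shows "trace (matrix_power X n) = \<nu> ^ n + \<mu> ^ n"
proof (induction n rule: induct_nat_012)
  case 0
  then show ?case by (simp add: trace_2 mat_def)
next
  case 1
  then show ?case using tr by simp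
next
  case (ge2 n)
  have "trace (matrix_power X (Suc (Suc n))) =
      trace X * trace (matrix_power X (Suc n)) - det X * trace (matrix_power X n)"
    by (simp add: trace_2 det_2 matrix_matrix_mult_def sum_2 algebra_simps)
  then show ?case
    unfolding ge2 tr det by (simp add: algebra_simps)
qed

text \<open>The trace is linear and continuous, so it passes through the series; the power sums then
  give two exponential series.\<close>

lemma trace_matrix_exp_2:
  fixes X :: "complex^2^2"
  assumes "trace X = \<nu> + \<mu>" and "det X = \<nu> * \<mu>"
  shows "trace (matrix_exp X) = exp \<nu> + exp \<mu>"
proof -
  have "bounded_linear (trace :: complex^2^2 \<Rightarrow> complex)"
    unfolding trace_2[abs_def]
    by (intro bounded_linear_add bounded_linear_compose[OF bounded_linear_vec_nth] bounded_linear_vec_nth)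
  then have "(\<lambda>n. trace ((1 / fact n) *\<^sub>R matrix_power X n)) sums trace (matrix_exp X)"
    unfolding matrix_exp_def by (rule bounded_linear.sums[OF _ summable_sums[OF summable_matrix_exp]])
  moreover have "trace ((1 / fact n) *\<^sub>R matrix_power X n) = \<nu> ^ n /\<^sub>R fact n + \<mu> ^ n /\<^sub>R fact n" for n
  proof -
    have "trace ((1 / fact n) *\<^sub>R matrix_power X n) = (1 / fact n) *\<^sub>R trace (matrix_power X n)"
      by (simp add: trace_2 scaleR_right_distrib)
    then show ?thesis
      by (simp add: trace_matrix_power_2[OF assms] scaleR_right_distrib inverse_eq_divide)
  qed
  moreover have "(\<lambda>n. \<nu> ^ n /\<^sub>R fact n + \<mu> ^ n /\<^sub>R fact n) sums (exp \<nu> + exp \<mu>)"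
    by (intro sums_add exp_converges)
  ultimately show ?thesis
    by (simp add: sums_unique2)
qed

lemma hermitian_2:
  assumes "hermitian (X :: complex^2^2)"
  shows "X $ 1 $ 1 = of_real (Re (X $ 1 $ 1))" and "X $ 2 $ 2 = of_real (Re (X $ 2 $ 2))"
    and "X $ 2 $ 1 = cnj (X $ 1 $ 2)"
proof -
  have "cnj (X $ j $ i) = X $ i $ j" for i j
    using assms unfolding hermitian_def vec_eq_iff by simp
  then show "X $ 1 $ 1 = of_real (Re (X $ 1 $ 1))" "X $ 2 $ 2 = of_real (Re (X $ 2 $ 2))"
    "X $ 2 $ 1 = cnj (X $ 1 $ 2)"
    by (metis Reals_cnj_iff of_real_Re)+
qed

lemma trace_matrix_exp_hermitian_2:
  fixes X :: "complex^2^2"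
  assumes "hermitian X"
  shows "trace (matrix_exp X) = of_real (2 * exp ((Re (X $ 1 $ 1) + Re (X $ 2 $ 2)) / 2) *
    cosh (sqrt (((Re (X $ 1 $ 1) - Re (X $ 2 $ 2)) / 2)\<^sup>2 + (cmod (X $ 1 $ 2))\<^sup>2)))"
proof -
  define x y where "x = Re (X $ 1 $ 1)" and "y = Re (X $ 2 $ 2)"
  \<comment> \<open>The eigenvalues are \<open>m + r\<close> and \<open>m - r\<close>: their sum is
    the trace and their product the determinant.\<close>
  define m r where "m = (x + y) / 2" and "r = sqrt (((x - y) / 2)\<^sup>2 + (cmod (X $ 1 $ 2))\<^sup>2)"
  note X = hermitian_2[OF assms, folded x_def y_def]
  have r: "r\<^sup>2 = ((x - y) / 2)\<^sup>2 + (cmod (X $ 1 $ 2))\<^sup>2"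
    by (simp add: r_def)
  have "trace X = of_real (m + r) + of_real (m - r)"
    unfolding trace_2 by (subst X(1), subst X(2)) (simp add: m_def flip: of_real_add of_real_diff)
  moreover have "det X = of_real (m + r) * of_real (m - r)"
  proof -
    have "det X = of_real (x * y - (cmod (X $ 1 $ 2))\<^sup>2)"
      unfolding det_2 by (subst X(1), subst X(2), subst X(3))
        (simp only: of_real_diff of_real_mult complex_norm_square)
    also have "x * y - (cmod (X $ 1 $ 2))\<^sup>2 = (m + r) * (m - r)"
      using r by (simp add: m_def power2_eq_square field_simps)
    finally show ?thesis by simp
  qed
  ultimately have "trace (matrix_exp X) = of_real (exp (m + r) + exp (m - r))"
    by (simp only: trace_matrix_exp_2 of_real_add[of "exp _"] exp_of_real)
  also have "exp (m + r) + exp (m - r) = 2 * exp m * cosh r"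
    by (simp add: cosh_field_def exp_add exp_diff exp_minus field_simps)
  finally show ?thesis
    by (simp add: m_def r_def x_def y_def)
qed

section \<open>The pencil \<open>t A + B\<close>\<close>

lemma hermitian_pencil:
  assumes "hermitian A" and "hermitian B"
  shows "hermitian (t *\<^sub>R A + B)"
  using assms unfolding hermitian_def vec_eq_iff by simp

theorem mainTheorem1:
  fixes A B :: "complex^2^2"
  assumes "hermitian A" and "hermitian B"
  shows "(\<forall>t::real. trace (matrix_exp (t *\<^sub>R A + B)) \<in> \<real>) \<and>
         exponentially_convex (\<lambda>t. Re (trace (matrix_exp (t *\<^sub>R A + B))))"
proof
  \<comment> \<open>The mean of the eigenvalues of \<open>t A + B\<close> is
    \<open>\<alpha> * t + \<beta>\<close>.\<close>
  define \<alpha> \<beta> where "\<alpha> = (Re (A $ 1 $ 1) + Re (A $ 2 $ 2)) / 2"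
    and "\<beta> = (Re (B $ 1 $ 1) + Re (B $ 2 $ 2)) / 2"
  define k l where "k = (Re (A $ 1 $ 1) - Re (A $ 2 $ 2)) / 2"
    and "l = (Re (B $ 1 $ 1) - Re (B $ 2 $ 2)) / 2"
  \<comment> \<open>These are the coefficients of the squared half-difference of the eigenvalues as
    a polynomial in \<open>t\<close>.\<close>
  define a b c where "a = k\<^sup>2 + (cmod (A $ 1 $ 2))\<^sup>2"
    and "b = k * l + Re (A $ 1 $ 2 * cnj (B $ 1 $ 2))"
    and "c = l\<^sup>2 + (cmod (B $ 1 $ 2))\<^sup>2"
  have quad: "(t * k + l)\<^sup>2 + (cmod (t *\<^sub>R (A $ 1 $ 2) + B $ 1 $ 2))\<^sup>2 = a * t\<^sup>2 + 2 * b * t + c" for t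
    unfolding a_def b_def c_def cmod_power2 by (simp add: power2_eq_square algebra_simps)
  have nonneg: "a * t\<^sup>2 + 2 * b * t + c \<ge> 0" for t
    unfolding quad[symmetric] by simp
  have eq: "trace (matrix_exp (t *\<^sub>R A + B)) =
      of_real (2 * exp \<beta> * (exp (\<alpha> * t) * cosh (sqrt (a * t\<^sup>2 + 2 * b * t + c))))" for t
  proof -
    have "(Re ((t *\<^sub>R A + B) $ 1 $ 1) + Re ((t *\<^sub>R A + B) $ 2 $ 2)) / 2 = \<beta> + \<alpha> * t"
      "(Re ((t *\<^sub>R A + B) $ 1 $ 1) - Re ((t *\<^sub>R A + B) $ 2 $ 2)) / 2 = t * k + l"
      "(t *\<^sub>R A + B) $ 1 $ 2 = t *\<^sub>R (A $ 1 $ 2) + B $ 1 $ 2"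
      by (simp_all add: \<alpha>_def \<beta>_def k_def l_def field_simps)
    then show ?thesis
      by (simp only: trace_matrix_exp_hermitian_2[OF hermitian_pencil[OF assms]] quad exp_add mult.assoc)
  qed
  show "\<forall>t::real. trace (matrix_exp (t *\<^sub>R A + B)) \<in> \<real>"
    unfolding eq by simp
  have "posdef (\<lambda>t. 2 * exp \<beta> * (exp (\<alpha> * t) * cosh (sqrt (a * t\<^sup>2 + 2 * b * t + c))))"
    by (intro posdef_cmult posdef_mult_exp posdef_cosh_sqrt_quadratic nonneg) simp
  then show "exponentially_convex (\<lambda>t. Re (trace (matrix_exp (t *\<^sub>R A + B))))"
    unfolding exponentially_convex_def eq Re_complex_of_real posdef_def
    by (auto intro!: continuous_intros)
qed

end
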